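(* Let $H_0\colon D(H_0)\subseteq\mathcal{H}\to\mathcal{H}$ be a densely defined, closed, skew-symmetric operator on a Hilbert space $\mathcal{H}$ and let $(\Omega,\mathcal{G}_1,\mathcal{G}_2,F,\omega)$ be a boundary system for $H_0$, where $\Omega$ is the standard symmetric form on $\mathcal{H}\oplus\mathcal{H}$ and $\omega$ is the standard unitary form on $\mathcal{G}_1\oplus\mathcal{G}_2$. Let $L_0\colon\mathcal{G}_1\to\mathcal{G}_2$ be a unitary operator. For $x\in D(H_0^\star)$ let $F_ix$ be the $i$-th component of $F(x,H_0^\star x)$ and let $(\mathcal{G}_1,\Gamma_1,\Gamma_2)$ be the boundary triplet for $H_0$ given by $\Gamma_1x=\frac{1}{\sqrt2}(F_1x+L_0^{-1}F_2x)$ and $\Gamma_2x=\frac{1}{\sqrt2}(F_1x-L_0^{-1}F_2x)$. Let $$\Psi\colon U(\mathcal{G}_1)\to\{H\colon D(H)\subseteq\mathcal{H}\to\mathcal{H} : H_0\subseteq H\text{ and }H=-H^\star\}$$ be the bijection defined by $\Psi(L)=-H_0^{\star}|_{D(\Psi(L))}$ with $$D(\Psi(L))=\{x\in D(-H_0^{\star}) : (L-1)\Gamma_1x+(L+1)\Gamma_2x=0\}.$$ Then the map $$\overline{\Psi}\colon U(\mathcal{G}_1,\mathcal{G}_2)\to\{H\colon D(H)\subseteq\mathcal{H}\to\mathcal{H} : H\subseteq H_0^{\star}\text{ and }H=-H^\star\}$$ which sends $L$ to the restriction of $H_0^\star$ to $\{x\in D(H_0^\star) : LF_1x=F_2x\}$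 is a bijection and is given by $$\overline{\Psi}(L)=-\Psi(L_0^{-1}L)\qquad\text{for all }L\in U(\mathcal{G}_1,\mathcal{G}_2).$$
   Context: $H_0$ is skew-symmetric if $H_0\subseteq -H_0^\star$. A densely defined operator $H$ is skew-self-adjoint if $H=-H^\star$. $U(\mathcal{G}_1,\mathcal{G}_2)$ is the set of unitary operators $\mathcal{G}_1\to\mathcal{G}_2$ and $U(\mathcal{G})=U(\mathcal{G},\mathcal{G})$. Note $D(-H_0^\star)=D(H_0^\star)$. Boundary system for $H_0$: a quintuple $(\Omega,\mathcal{G}_1,\mathcal{G}_2,F,\omega)$ where $\Omega$ is a sesquilinear form on $\mathcal{H}\oplus\mathcal{H}$, $\mathcal{G}_1,\mathcal{G}_2$ are Hilbert spaces, $\omega$ is a sesquilinear form on $\mathcal{G}_1\oplus\mathcal{G}_2$, and $F\colon\operatorname{Graph}(H_0^{\star})\to\mathcal{G}_1\oplus\mathcal{G}_2$ is a surjective map such that $\Omega((x,H_0^{\star}x),(y,H_0^{\star}y))=\omega(F(x,H_0^{\star}x),F(y,H_0^{\star}y))$ for all $x,y\in D(H_0^{\star})$. Standard symmetric form on $\mathcal{H}\oplus\mathcal{H}$: $\Omega((x,y),(u,v))=(x,v)_{\mathcal{H}}+(y,u)_{\mathcal{H}}$. Standard unitary form on $\mathcal{G}_1\oplus\mathcal{G}_2$: $\omega((x,y),(u,v))=(x,u)_{\mathcal{G}_1}-(y,v)_{\mathcal{G}_2}$. Boundary triplet for $H_0$: a triple $(\mathcal{G},\Gamma_1,\Gamma_2)$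 where $\mathcal{G}$ is a Hilbert space and $\Gamma_1,\Gamma_2\colon D(-H_0^{\star})\to\mathcal{G}$ are linear maps such that $D(-H_0^{\star})\to\mathcal{G}\oplus\mathcal{G}$, $x\mapsto(\Gamma_1x,\Gamma_2x)$ is surjective and $(H_0^{\star}x,y)_{\mathcal{H}}+(x,H_0^{\star}y)_{\mathcal{H}}=(\Gamma_1x,\Gamma_2y)_{\mathcal{G}}+(\Gamma_2x,\Gamma_1y)_{\mathcal{G}}$ for all $x,y\in D(-H_0^{\star})$. It is a known fact (Gorbachuk–Gorbachuk) that for any boundary triplet $(\mathcal{G},\Gamma_1,\Gamma_2)$ of a skew-symmetric $H_0$ the map $\Psi$ (defined as in the claim on $U(\mathcal{G})$) is a bijection onto the set of skew-self-adjoint extensions of $H_0$. That $(\mathcal{G}_1,\Gamma_1,\Gamma_2)$ as defined in the claim is a boundary triplet is a separate result. *)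

theory Defs
  imports "HOL-Analysis.Analysis"
begin

section \<open>Complex Hilbert spaces\<close>

class complex_vector = real_vector +
  fixes scaleC :: "complex \<Rightarrow> 'a \<Rightarrow> 'a"  (infixr \<open>*\<^sub>C\<close> 75)
  assumes scaleC_add_right: "a *\<^sub>C (x + y) = a *\<^sub>C x + a *\<^sub>C y"
    and scaleC_add_left: "(a + b) *\<^sub>C x = a *\<^sub>C x + b *\<^sub>C x"
    and scaleC_scaleC: "a *\<^sub>C (b *\<^sub>C x) = (a * b) *\<^sub>C x"
    and scaleC_of_real: "complex_of_real r *\<^sub>C x = r *\<^sub>R x"

instantiation prod :: (complex_vector, complex_vector) complex_vector
begin

definition scaleC_prod :: "complex \<Rightarrow> 'a \<times> 'b \<Rightarrow> 'a \<times> 'b" where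
  "scaleC_prod a p = (a *\<^sub>C fst p, a *\<^sub>C snd p)"

instance
  by standard
    (simp_all add: scaleC_prod_def prod_eq_iff scaleC_add_right scaleC_add_left
      scaleC_scaleC scaleC_of_real)

end

text \<open>The inner product is linear in the first and antilinear in the second argument.
  Positive definiteness is contained in \<open>cinner_self\<close>.\<close>

class chilbert_space = complex_vector + banach +
  fixes cinner :: "'a \<Rightarrow> 'a \<Rightarrow> complex"
  assumes cinner_commute: "cinner x y = cnj (cinner y x)"
    and cinner_add_left: "cinner (x + y) z = cinner x z + cinner y z"
    and cinner_scaleC_left: "cinner (a *\<^sub>C x) y = a * cinner x y"
    and cinner_self: "cinner x x = complex_of_real ((norm x)\<^sup>2)"

instantiation complex :: chilbert_space
begin

definition scaleC_complex :: "complex \<Rightarrow> complex \<Rightarrow> complex" where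
  "scaleC_complex a x = a * x"

definition cinner_complex :: "complex \<Rightarrow> complex \<Rightarrow> complex" where
  "cinner_complex x y = x * cnj y"

instance
  by standard
    (simp_all add: scaleC_complex_def cinner_complex_def algebra_simps scaleR_conv_of_real
      complex_norm_square[symmetric] del: of_real_power)

end

definition csubspace :: "'a::complex_vector set \<Rightarrow> bool" where
  "csubspace S \<longleftrightarrow> 0 \<in> S \<and> (\<forall>x\<in>S. \<forall>y\<in>S. x + y \<in> S) \<and> (\<forall>a. \<forall>x\<in>S. a *\<^sub>C x \<in> S)"

definition clinear_on :: "'a::complex_vector set \<Rightarrow> ('a \<Rightarrow> 'b::complex_vector) \<Rightarrow> bool" where
  "clinear_on S f \<longleftrightarrow> csubspace S \<and>
     (\<forall>x\<in>S. \<forall>y\<in>S. f (x + y) = f x + f y) \<and>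
     (\<forall>a. \<forall>x\<in>S. f (a *\<^sub>C x) = a *\<^sub>C f x)"

definition sesquilinear :: "('a::complex_vector \<Rightarrow> 'a \<Rightarrow> complex) \<Rightarrow> bool" where
  "sesquilinear B \<longleftrightarrow>
     (\<forall>x y z. B (x + y) z = B x z + B y z) \<and> (\<forall>a x y. B (a *\<^sub>C x) y = a * B x y) \<and>
     (\<forall>x y z. B x (y + z) = B x y + B x z) \<and> (\<forall>a x y. B x (a *\<^sub>C y) = cnj a * B x y)"

definition unitary_operators :: "('a::chilbert_space \<Rightarrow> 'b::chilbert_space) set" where
  "unitary_operators =
     {L. clinear_on UNIV L \<and> surj L \<and> (\<forall>x y. cinner (L x) (L y) = cinner x y)}"


section \<open>Unbounded operators\<close>

text \<open>An operator \<open>H: D(H) \<subseteq> \<H> \<rightarrow> \<H>\<close> is a partial function with \<open>D(H) = dom H\<close>.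
  Thus \<open>H \<subseteq> K\<close> is \<open>H \<subseteq>\<^sub>m K\<close>, the restriction of \<open>H\<close> to \<open>D\<close> is \<open>H |` D\<close>, and
  the graph is \<^const>\<open>Map.graph\<close>.\<close>

definition linear_operator :: "('h::complex_vector \<rightharpoonup> 'h) \<Rightarrow> bool" where
  "linear_operator H \<longleftrightarrow> clinear_on (dom H) (\<lambda>x. the (H x))"

definition densely_defined :: "('h::chilbert_space \<rightharpoonup> 'h) \<Rightarrow> bool" where
  "densely_defined H \<longleftrightarrow> linear_operator H \<and> closure (dom H) = UNIV"

definition closed_operator :: "('h::chilbert_space \<rightharpoonup> 'h) \<Rightarrow> bool" where
  "closed_operator H \<longleftrightarrow> linear_operator H \<and> closed (Map.graph H)"

definition op_neg :: "('h::chilbert_space \<rightharpoonup> 'h) \<Rightarrow> ('h \<rightharpoonup> 'h)" where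
  "op_neg H = (\<lambda>x. map_option uminus (H x))"

text \<open>Only meaningful if \<open>dom H\<close> is dense; otherwise the value \<open>z\<close> is not unique.\<close>

definition op_adjoint :: "('h::chilbert_space \<rightharpoonup> 'h) \<Rightarrow> ('h \<rightharpoonup> 'h)" where
  "op_adjoint H = (\<lambda>y.
     if \<exists>z. \<forall>x\<in>dom H. cinner (the (H x)) y = cinner x z
     then Some (THE z. \<forall>x\<in>dom H. cinner (the (H x)) y = cinner x z)
     else None)"

definition skew_symmetric :: "('h::chilbert_space \<rightharpoonup> 'h) \<Rightarrow> bool" where
  "skew_symmetric H \<longleftrightarrow> H \<subseteq>\<^sub>m op_neg (op_adjoint H)"

definition skew_self_adjoint :: "('h::chilbert_space \<rightharpoonup> 'h) \<Rightarrow> bool" where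
  "skew_self_adjoint H \<longleftrightarrow> densely_defined H \<and> H = op_neg (op_adjoint H)"


section \<open>Boundary systems and boundary triplets\<close>

definition standard_symmetric_form :: "'h::chilbert_space \<times> 'h \<Rightarrow> 'h \<times> 'h \<Rightarrow> complex" where
  "standard_symmetric_form p q = cinner (fst p) (snd q) + cinner (snd p) (fst q)"

definition standard_unitary_form ::
    "'g1::chilbert_space \<times> 'g2::chilbert_space \<Rightarrow> 'g1 \<times> 'g2 \<Rightarrow> complex" where
  "standard_unitary_form p q = cinner (fst p) (fst q) - cinner (snd p) (snd q)"

text \<open>The spaces \<open>\<G>\<^sub>1\<close>, \<open>\<G>\<^sub>2\<close> are the types \<open>'g1\<close>, \<open>'g2\<close>. Only the values of \<open>F\<close> on the graph of
  \<open>H\<^sub>0\<^sup>\<star>\<close> matter.\<close>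

definition boundary_system ::
    "('h::chilbert_space \<rightharpoonup> 'h) \<Rightarrow> ('h \<times> 'h \<Rightarrow> 'h \<times> 'h \<Rightarrow> complex) \<Rightarrow>
     ('h \<times> 'h \<Rightarrow> 'g1::chilbert_space \<times> 'g2::chilbert_space) \<Rightarrow>
     ('g1 \<times> 'g2 \<Rightarrow> 'g1 \<times> 'g2 \<Rightarrow> complex) \<Rightarrow> bool" where
  "boundary_system H0 \<Omega> F \<omega> \<longleftrightarrow>
     sesquilinear \<Omega> \<and> sesquilinear \<omega> \<and>
     F ` Map.graph (op_adjoint H0) = UNIV \<and>
     (\<forall>x\<in>dom (op_adjoint H0). \<forall>y\<in>dom (op_adjoint H0).
        \<Omega> (x, the (op_adjoint H0 x)) (y, the (op_adjoint H0 y)) =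
        \<omega> (F (x, the (op_adjoint H0 x))) (F (y, the (op_adjoint H0 y))))"

definition boundary_triplet ::
    "('h::chilbert_space \<rightharpoonup> 'h) \<Rightarrow> ('h \<Rightarrow> 'g::chilbert_space) \<Rightarrow> ('h \<Rightarrow> 'g) \<Rightarrow> bool" where
  "boundary_triplet H0 \<Gamma>1 \<Gamma>2 \<longleftrightarrow>
     clinear_on (dom (op_neg (op_adjoint H0))) \<Gamma>1 \<and>
     clinear_on (dom (op_neg (op_adjoint H0))) \<Gamma>2 \<and>
     (\<lambda>x. (\<Gamma>1 x, \<Gamma>2 x)) ` dom (op_neg (op_adjoint H0)) = UNIV \<and>
     (\<forall>x\<in>dom (op_neg (op_adjoint H0)). \<forall>y\<in>dom (op_neg (op_adjoint H0)).
        cinner (the (op_adjoint H0 x)) y + cinner x (the (op_adjoint H0 y)) =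
        cinner (\<Gamma>1 x) (\<Gamma>2 y) + cinner (\<Gamma>2 x) (\<Gamma>1 y))"

definition boundary_comp1 ::
    "('h::chilbert_space \<rightharpoonup> 'h) \<Rightarrow> ('h \<times> 'h \<Rightarrow> 'g1 \<times> 'g2) \<Rightarrow> 'h \<Rightarrow> 'g1" where
  "boundary_comp1 H0 F x = fst (F (x, the (op_adjoint H0 x)))"

definition boundary_comp2 ::
    "('h::chilbert_space \<rightharpoonup> 'h) \<Rightarrow> ('h \<times> 'h \<Rightarrow> 'g1 \<times> 'g2) \<Rightarrow> 'h \<Rightarrow> 'g2" where
  "boundary_comp2 H0 F x = snd (F (x, the (op_adjoint H0 x)))"

text \<open>The map \<open>\<Psi>\<close> of a boundary triplet.\<close>

definition triplet_extension ::
    "('h::chilbert_space \<rightharpoonup> 'h) \<Rightarrow> ('h \<Rightarrow> 'g::chilbert_space) \<Rightarrow> ('h \<Rightarrow> 'g) \<Rightarrow>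
     ('g \<Rightarrow> 'g) \<Rightarrow> ('h \<rightharpoonup> 'h)" where
  "triplet_extension H0 \<Gamma>1 \<Gamma>2 L =
     op_neg (op_adjoint H0) |`
       {x \<in> dom (op_neg (op_adjoint H0)). (L (\<Gamma>1 x) - \<Gamma>1 x) + (L (\<Gamma>2 x) + \<Gamma>2 x) = 0}"

text \<open>The map \<open>\<Psi>\<close>-bar of a boundary system.\<close>

definition system_restriction ::
    "('h::chilbert_space \<rightharpoonup> 'h) \<Rightarrow> ('h \<times> 'h \<Rightarrow> 'g1::chilbert_space \<times> 'g2::chilbert_space) \<Rightarrow>
     ('g1 \<Rightarrow> 'g2) \<Rightarrow> ('h \<rightharpoonup> 'h)" where
  "system_restriction H0 F L =
     op_adjoint H0 |`
       {x \<in> dom (op_adjoint H0). L (boundary_comp1 H0 F x) = boundary_comp2 H0 F x}"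


section \<open>The boundary triplet of a boundary system\<close>

lemma cinner_add_right: "cinner x (y + z) = cinner x y + cinner x z"
  for x :: "'a::chilbert_space"
  by (metis cinner_commute cinner_add_left complex_cnj_add)

lemma cinner_scaleC_right: "cinner x (a *\<^sub>C y) = cnj a * cinner x y"
  for x :: "'a::chilbert_space"
  by (metis cinner_commute cinner_scaleC_left complex_cnj_mult)

lemma cinner_minus_left: "cinner (- x) y = - cinner x y"
  for x :: "'a::chilbert_space"
  by (metis add.right_inverse add_eq_0_iff add_cancel_left_left cinner_add_left)

lemma cinner_minus_right: "cinner x (- y) = - cinner x y"
  for x :: "'a::chilbert_space"
  by (metis cinner_commute cinner_minus_left complex_cnj_minus)

lemma cinner_diff_left: "cinner (x - y) z = cinner x z - cinner y z"
  for x :: "'a::chilbert_space"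
  using cinner_add_left[of x "- y" z] by (simp add: cinner_minus_left)

lemma cinner_diff_right: "cinner x (y - z) = cinner x y - cinner x z"
  for x :: "'a::chilbert_space"
  using cinner_add_right[of x y "- z"] by (simp add: cinner_minus_right)

lemma cinner_scaleR_left: "cinner (r *\<^sub>R x) y = complex_of_real r * cinner x y"
  for x :: "'a::chilbert_space"
  by (metis cinner_scaleC_left scaleC_of_real)

lemma cinner_scaleR_right: "cinner x (r *\<^sub>R y) = complex_of_real r * cinner x y"
  for x :: "'a::chilbert_space"
  by (metis cinner_scaleC_right scaleC_of_real complex_cnj_complex_of_real)

lemma sesquilinear_standard_symmetric_form: "sesquilinear standard_symmetric_form"
  by (simp add: sesquilinear_def standard_symmetric_form_def scaleC_prod_def cinner_add_left
      cinner_add_right cinner_scaleC_left cinner_scaleC_right algebra_simps)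

lemma sesquilinear_standard_unitary_form: "sesquilinear standard_unitary_form"
  by (simp add: sesquilinear_def standard_unitary_form_def scaleC_prod_def cinner_add_left
      cinner_add_right cinner_scaleC_left cinner_scaleC_right algebra_simps)

lemma standard_unitary_form_nondegenerate:
  fixes p :: "'a::chilbert_space \<times> 'b::chilbert_space"
  assumes "\<And>q. standard_unitary_form p q = 0"
  shows "p = 0"
proof -
  have "standard_unitary_form p (fst p, - snd p) = 0" by (rule assms)
  then have "complex_of_real ((norm (fst p))\<^sup>2 + (norm (snd p))\<^sup>2) = 0"
    by (simp add: standard_unitary_form_def cinner_minus_right cinner_self)
  then have "(norm (fst p))\<^sup>2 + (norm (snd p))\<^sup>2 = 0" by (simp only: of_real_eq_0_iff)
  then show ?thesis by (simp add: sum_power2_eq_zero_iff prod_eq_iff)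
qed

lemma dense_cinner_unique:
  fixes z z' :: "'h::chilbert_space"
  assumes "closure D = UNIV" and "\<And>x. x \<in> D \<Longrightarrow> cinner x z = cinner x z'"
  shows "z = z'"
proof (rule ccontr)
  define w where "w = z - z'"
  assume "z \<noteq> z'"
  then have pos: "norm w > 0" by (simp add: w_def)
  from assms(1) have "w \<in> closure D" by simp
  then obtain x where x: "x \<in> D" "dist x w < norm w"
    using pos unfolding closure_approachable by blast
  have xw: "cinner x w = 0" using assms(2)[OF x(1)] by (simp add: w_def cinner_diff_right)
  then have wx: "cinner w x = 0" by (metis cinner_commute complex_cnj_zero)
  have "complex_of_real ((norm (x - w))\<^sup>2) = complex_of_real ((norm x)\<^sup>2 + (norm w)\<^sup>2)"
    unfolding cinner_self[symmetric] of_real_add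
    by (simp add: cinner_diff_left cinner_diff_right xw wx)
  then have "(norm (x - w))\<^sup>2 = (norm x)\<^sup>2 + (norm w)\<^sup>2" by (simp only: of_real_eq_iff)
  then have "(norm w)\<^sup>2 \<le> (norm (x - w))\<^sup>2" by simp
  then have "norm w \<le> norm (x - w)" by (rule power2_le_imp_le) simp
  with x(2) show False by (simp add: dist_norm)
qed

lemma op_adjoint_eq_Some_iff:
  assumes "closure (dom H) = UNIV"
  shows "op_adjoint H y = Some z \<longleftrightarrow> (\<forall>x\<in>dom H. cinner (the (H x)) y = cinner x z)"
proof -
  have the_eq: "(THE u. \<forall>x\<in>dom H. cinner (the (H x)) y = cinner x u) = z'"
    if "\<forall>x\<in>dom H. cinner (the (H x)) y = cinner x z'" for z'
  proof (rule the_equality)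
    fix u assume "\<forall>x\<in>dom H. cinner (the (H x)) y = cinner x u"
    then show "u = z'" using that by (intro dense_cinner_unique[OF assms]) metis
  qed (rule that)
  show ?thesis
    unfolding op_adjoint_def using the_eq by (smt (verit) option.distinct(1) option.inject)
qed

lemma dom_op_neg [simp]: "dom (op_neg H) = dom H"
  by (auto simp: op_neg_def dom_def)

lemma linear_operator_op_adjoint:
  assumes "closure (dom H) = UNIV"
  shows "linear_operator (op_adjoint H)"
proof -
  note iff = op_adjoint_eq_Some_iff[OF assms]
  have zero: "op_adjoint H 0 = Some 0"
    unfolding iff by (metis cinner_diff_right diff_self)
  have add: "op_adjoint H (x + y) = Some (u + v)"
    if "op_adjoint H x = Some u" "op_adjoint H y = Some v" for x y u v
    using that unfolding iff by (simp add: cinner_add_right)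
  have scale: "op_adjoint H (a *\<^sub>C x) = Some (a *\<^sub>C u)"
    if "op_adjoint H x = Some u" for a x u
    using that unfolding iff by (simp add: cinner_scaleC_right)
  show ?thesis
    unfolding linear_operator_def clinear_on_def csubspace_def
    using zero add scale by (auto simp: dom_def)
qed

text \<open>A boundary map is linear although this is not required in its definition.\<close>

lemma boundary_system_clinear:
  fixes H0 :: "'h::chilbert_space \<rightharpoonup> 'h"
    and F :: "'h \<times> 'h \<Rightarrow> 'g1::chilbert_space \<times> 'g2::chilbert_space"
  assumes dense: "closure (dom H0) = UNIV"
    and bs: "boundary_system H0 standard_symmetric_form F standard_unitary_form"
  shows "clinear_on (dom (op_adjoint H0)) (\<lambda>x. F (x, the (op_adjoint H0 x)))"
proof -
  let ?D = "dom (op_adjoint H0)"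
  let ?A = "\<lambda>x. the (op_adjoint H0 x)"
  let ?\<Omega> = "standard_symmetric_form :: 'h \<times> 'h \<Rightarrow> _"
  let ?\<omega> = "standard_unitary_form :: 'g1 \<times> 'g2 \<Rightarrow> _"
  define f where "f x = F (x, ?A x)" for x
  have lin: "clinear_on ?D ?A"
    using linear_operator_op_adjoint[OF dense] by (simp add: linear_operator_def)
  have green: "?\<Omega> (x, ?A x) (y, ?A y) = ?\<omega> (f x) (f y)" if "x \<in> ?D" "y \<in> ?D" for x y
    using bs that by (simp add: boundary_system_def f_def)
  have surj: "\<exists>x\<in>?D. f x = q" for q
  proof -
    have "q \<in> F ` Map.graph (op_adjoint H0)" using bs by (simp add: boundary_system_def)
    then show ?thesis by (auto simp: Map.graph_def f_def dom_def)
  qed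
  have sesq: "?\<omega> (p - q) s = ?\<omega> p s - ?\<omega> q s" "?\<omega> (p + q) s = ?\<omega> p s + ?\<omega> q s"
    "?\<omega> (a *\<^sub>C p) s = a * ?\<omega> p s" for p q s a
    by (simp_all add: standard_unitary_form_def scaleC_prod_def cinner_diff_left cinner_add_left
        cinner_scaleC_left algebra_simps)
  have eqI: "p = q" if "\<And>z. z \<in> ?D \<Longrightarrow> ?\<omega> p (f z) = ?\<omega> q (f z)" for p q
  proof -
    have "?\<omega> (p - q) s = 0" for s using surj[of s] that by (auto simp: sesq)
    then have "p - q = 0" by (rule standard_unitary_form_nondegenerate)
    then show ?thesis by simp
  qed
  have add: "f (x + y) = f x + f y" if "x \<in> ?D" "y \<in> ?D" for x y
  proof (rule eqI)
    fix z assume z: "z \<in> ?D"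
    have xy: "x + y \<in> ?D" "?A (x + y) = ?A x + ?A y"
      using lin that by (auto simp: clinear_on_def csubspace_def)
    show "?\<omega> (f (x + y)) (f z) = ?\<omega> (f x + f y) (f z)"
      unfolding sesq green[OF xy(1) z, symmetric] green[OF that(1) z, symmetric]
        green[OF that(2) z, symmetric]
      by (simp add: xy(2) standard_symmetric_form_def cinner_add_left)
  qed
  have scale: "f (a *\<^sub>C x) = a *\<^sub>C f x" if "x \<in> ?D" for a x
  proof (rule eqI)
    fix z assume z: "z \<in> ?D"
    have ax: "a *\<^sub>C x \<in> ?D" "?A (a *\<^sub>C x) = a *\<^sub>C ?A x"
      using lin that by (auto simp: clinear_on_def csubspace_def)
    show "?\<omega> (f (a *\<^sub>C x)) (f z) = ?\<omega> (a *\<^sub>C f x) (f z)"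
      unfolding sesq green[OF ax(1) z, symmetric] green[OF that(1) z, symmetric]
      by (simp add: ax(2) standard_symmetric_form_def cinner_scaleC_left algebra_simps)
  qed
  show ?thesis
    using lin add scale unfolding clinear_on_def f_def by blast
qed

lemma boundary_triplet_of_boundary_system:
  fixes H0 :: "'h::chilbert_space \<rightharpoonup> 'h"
    and F :: "'h \<times> 'h \<Rightarrow> 'g1::chilbert_space \<times> 'g2::chilbert_space"
    and L0 :: "'g1 \<Rightarrow> 'g2"
  assumes dense: "densely_defined H0"
    and bs: "boundary_system H0 standard_symmetric_form F standard_unitary_form"
    and L0: "L0 \<in> unitary_operators"
    and \<Gamma>1: "\<And>x. x \<in> dom (op_adjoint H0) \<Longrightarrow>
      \<Gamma>1 x = (1 / sqrt 2) *\<^sub>R (boundary_comp1 H0 F x + inv L0 (boundary_comp2 H0 F x))"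
    and \<Gamma>2: "\<And>x. x \<in> dom (op_adjoint H0) \<Longrightarrow>
      \<Gamma>2 x = (1 / sqrt 2) *\<^sub>R (boundary_comp1 H0 F x - inv L0 (boundary_comp2 H0 F x))"
  shows "boundary_triplet H0 \<Gamma>1 \<Gamma>2"
proof -
  let ?D = "dom (op_adjoint H0)"
  let ?A = "\<lambda>x. the (op_adjoint H0 x)"
  define F1 where "F1 = boundary_comp1 H0 F"
  define F2 where "F2 x = inv L0 (boundary_comp2 H0 F x)" for x
  have L0_lin: "L0 (x + y) = L0 x + L0 y" "L0 (a *\<^sub>C x) = a *\<^sub>C L0 x"
    and L0_inner: "cinner (L0 x) (L0 y) = cinner x y" and L0_surj: "surj L0" for x y a
    using L0 by (auto simp: unitary_operators_def clinear_on_def)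
  have "inj L0"
  proof (rule injI)
    fix x y assume eq: "L0 x = L0 y"
    have "L0 ((x - y) + y) = L0 (x - y) + L0 y" by (rule L0_lin)
    then have "L0 (x - y) = 0" using eq by simp
    then have "cinner (x - y) (x - y) = 0"
      by (metis L0_inner cinner_self norm_zero of_real_0 zero_power2)
    then show "x = y" by (simp add: cinner_self)
  qed
  have L0_inv: "L0 (inv L0 v) = v" "inv L0 (L0 u) = u" for u v
    using L0_surj \<open>inj L0\<close> by (simp_all add: surj_f_inv_f)
  have inv_inner: "cinner (inv L0 u) (inv L0 v) = cinner u v" for u v
    by (metis L0_inner L0_inv(1))
  have inv_add: "inv L0 (u + v) = inv L0 u + inv L0 v" for u v
    by (metis L0_inv L0_lin(1))
  have inv_scale: "inv L0 (a *\<^sub>C u) = a *\<^sub>C inv L0 u" for a u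
    by (metis L0_inv L0_lin(2))
  have "clinear_on ?D (\<lambda>x. F (x, ?A x))"
    using dense bs by (intro boundary_system_clinear) (simp_all add: densely_defined_def)
  then have sub: "csubspace ?D"
    and F_lin: "\<And>x y. x \<in> ?D \<Longrightarrow> y \<in> ?D \<Longrightarrow> F (x + y, ?A (x + y)) = F (x, ?A x) + F (y, ?A y)"
      "\<And>a x. x \<in> ?D \<Longrightarrow> F (a *\<^sub>C x, ?A (a *\<^sub>C x)) = a *\<^sub>C F (x, ?A x)"
    unfolding clinear_on_def by blast+
  have F1_lin: "F1 (x + y) = F1 x + F1 y" "F1 (a *\<^sub>C x) = a *\<^sub>C F1 x"
    and F2_lin: "F2 (x + y) = F2 x + F2 y" "F2 (a *\<^sub>C x) = a *\<^sub>C F2 x"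
    if "x \<in> ?D" "y \<in> ?D" for x y a
    using F_lin that by (simp_all add: F1_def F2_def boundary_comp1_def boundary_comp2_def
        inv_add inv_scale scaleC_prod_def)
  have G1: "\<Gamma>1 x = (1 / sqrt 2) *\<^sub>R (F1 x + F2 x)"
    and G2: "\<Gamma>2 x = (1 / sqrt 2) *\<^sub>R (F1 x - F2 x)" if "x \<in> ?D" for x
    using \<Gamma>1[OF that] \<Gamma>2[OF that] by (simp_all add: F1_def F2_def)
  have mem: "x + y \<in> ?D" "a *\<^sub>C x \<in> ?D" if "x \<in> ?D" "y \<in> ?D" for x y a
    using sub that by (auto simp: csubspace_def)
  have scale_comm: "r *\<^sub>R (a *\<^sub>C v) = a *\<^sub>C (r *\<^sub>R v)" for r a and v :: 'g1
    by (metis scaleC_of_real scaleC_scaleC mult.commute)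
  have scale_diff: "a *\<^sub>C (u - v) = a *\<^sub>C u - a *\<^sub>C v" for a and u v :: 'g1
    by (metis scaleC_add_right add_diff_cancel diff_add_cancel)
  have lin1: "clinear_on ?D \<Gamma>1"
    unfolding clinear_on_def
  proof (intro conjI sub ballI allI)
    fix x y a assume x: "x \<in> ?D"
    show "\<Gamma>1 (a *\<^sub>C x) = a *\<^sub>C \<Gamma>1 x"
      by (simp only: G1 x mem[OF x x] F1_lin[OF x x] F2_lin[OF x x]
          scaleC_add_right[symmetric] scale_comm)
    assume y: "y \<in> ?D"
    show "\<Gamma>1 (x + y) = \<Gamma>1 x + \<Gamma>1 y"
      by (simp add: G1 x y mem[OF x y] F1_lin[OF x y] F2_lin[OF x y] algebra_simps)
  qed
  have lin2: "clinear_on ?D \<Gamma>2"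
    unfolding clinear_on_def
  proof (intro conjI sub ballI allI)
    fix x y a assume x: "x \<in> ?D"
    show "\<Gamma>2 (a *\<^sub>C x) = a *\<^sub>C \<Gamma>2 x"
      by (simp only: G2 x mem[OF x x] F1_lin[OF x x] F2_lin[OF x x]
          scale_diff[symmetric] scale_comm)
    assume y: "y \<in> ?D"
    show "\<Gamma>2 (x + y) = \<Gamma>2 x + \<Gamma>2 y"
      by (simp add: G2 x y mem[OF x y] F1_lin[OF x y] F2_lin[OF x y] algebra_simps)
  qed
  have surj: "(\<lambda>x. (\<Gamma>1 x, \<Gamma>2 x)) ` ?D = UNIV"
  proof -
    have "(p, q) \<in> (\<lambda>x. (\<Gamma>1 x, \<Gamma>2 x)) ` ?D" for p q
    proof -
      let ?v = "((1 / sqrt 2) *\<^sub>R (p + q), L0 ((1 / sqrt 2) *\<^sub>R (p - q)))"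
      have "?v \<in> F ` Map.graph (op_adjoint H0)" using bs by (simp add: boundary_system_def)
      then obtain x z where xz: "op_adjoint H0 x = Some z" "F (x, z) = ?v"
        by (auto simp: Map.graph_def)
      then have x: "x \<in> ?D" "F (x, ?A x) = ?v" by auto
      have F12: "F1 x = (1 / sqrt 2) *\<^sub>R (p + q)" "F2 x = (1 / sqrt 2) *\<^sub>R (p - q)"
        using x(2) by (simp_all add: F1_def F2_def boundary_comp1_def boundary_comp2_def L0_inv)
      have "\<Gamma>1 x = (1 / sqrt 2) *\<^sub>R (1 / sqrt 2) *\<^sub>R (2 *\<^sub>R p)"
        unfolding G1[OF x(1)] F12 by (simp add: scaleR_2 algebra_simps)
      moreover have "\<Gamma>2 x = (1 / sqrt 2) *\<^sub>R (1 / sqrt 2) *\<^sub>R (2 *\<^sub>R q)"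
        unfolding G2[OF x(1)] F12 by (simp add: scaleR_2 algebra_simps)
      ultimately show ?thesis using x(1) by force
    qed
    then show ?thesis by auto
  qed
  have green: "cinner (?A x) y + cinner x (?A y) = cinner (\<Gamma>1 x) (\<Gamma>2 y) + cinner (\<Gamma>2 x) (\<Gamma>1 y)"
    if x: "x \<in> ?D" and y: "y \<in> ?D" for x y
  proof -
    have half: "complex_of_real (1 / sqrt 2) * complex_of_real (1 / sqrt 2) = 1 / 2"
      unfolding of_real_mult[symmetric] by simp
    have "cinner (\<Gamma>1 x) (\<Gamma>2 y) + cinner (\<Gamma>2 x) (\<Gamma>1 y) =
        (complex_of_real (1 / sqrt 2) * complex_of_real (1 / sqrt 2)) *
        (2 * cinner (F1 x) (F1 y) - 2 * cinner (F2 x) (F2 y))"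
      unfolding G1[OF x] G2[OF x] G1[OF y] G2[OF y] cinner_scaleR_left cinner_scaleR_right
        cinner_add_left cinner_diff_left cinner_add_right cinner_diff_right
      by algebra
    also have "\<dots> = cinner (F1 x) (F1 y) - cinner (F2 x) (F2 y)"
      unfolding half by (simp add: algebra_simps)
    also have "\<dots> = standard_unitary_form (F (x, ?A x)) (F (y, ?A y))"
      by (simp add: standard_unitary_form_def F1_def F2_def boundary_comp1_def boundary_comp2_def
          inv_inner)
    also have "\<dots> = standard_symmetric_form (x, ?A x) (y, ?A y)"
      using bs x y by (simp add: boundary_system_def)
    finally show ?thesis by (simp add: standard_symmetric_form_def)
  qed
  show ?thesis
    unfolding boundary_triplet_def dom_op_neg using lin1 lin2 surj green by blast
qed

end

theory Submission
  imports Defs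
begin

text \<open>Write \<open>A = H\<^sub>0\<^sup>\<star>\<close>, and let \<open>f\<close> be the boundary map \<open>x \<mapsto> F (x, A x)\<close>. Green's identity
  translates adjoints of restrictions of \<open>A\<close> into \<open>\<omega>\<close>-orthogonal complements: a restriction \<open>H\<close> of
  \<open>A\<close> is skew-self-adjoint iff \<open>dom H\<close> is the preimage under \<open>f\<close> of a set \<open>R\<close> which equals its own
  \<open>\<omega>\<close>-complement. Such a set \<open>R\<close> is the graph of a unitary operator: on \<open>R\<close> the two components have
  equal norm, so the projection of \<open>R\<close> to either factor is injective with closed range, and a vector
  \<open>g\<close> orthogonal to the range gives \<open>(g, 0) \<in> R\<close> (or \<open>(0, g) \<in> R\<close>), that is, \<open>g = 0\<close>.\<close>

section \<open>Orthogonal projections\<close>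

lemma cinner_zero_left [simp]: "cinner 0 x = 0"
  for x :: "'a::chilbert_space"
  using cinner_diff_left[of x x x] cinner_diff_left[of 0 0 x] by simp

lemma cinner_zero_right [simp]: "cinner x 0 = 0"
  for x :: "'a::chilbert_space"
  using cinner_diff_right[of x 0 0] by simp

lemma cinner_self_eq_0_iff: "cinner x x = 0 \<longleftrightarrow> x = 0"
  for x :: "'a::chilbert_space"
  by (simp add: cinner_self)

lemma parallelogram_law:
  fixes x y :: "'a::chilbert_space"
  shows "(norm (x + y))\<^sup>2 + (norm (x - y))\<^sup>2 = 2 * (norm x)\<^sup>2 + 2 * (norm y)\<^sup>2"
proof -
  have "complex_of_real ((norm (x + y))\<^sup>2 + (norm (x - y))\<^sup>2) =
      complex_of_real (2 * (norm x)\<^sup>2 + 2 * (norm y)\<^sup>2)"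
    unfolding of_real_add of_real_mult cinner_self[symmetric]
    by (simp add: cinner_add_left cinner_add_right cinner_diff_left cinner_diff_right)
  then show ?thesis by (simp only: of_real_eq_iff)
qed

text \<open>Pythagoras: the residual of \<open>e\<close> after removing its component along
  \<open>t\<close> is orthogonal to \<open>t\<close>. This yields both the variational argument for
  orthogonal projections and the Cauchy-Schwarz inequality.\<close>

lemma norm_diff_projection_square:
  fixes e t :: "'a::chilbert_space"
  assumes "t \<noteq> 0"
  shows "(norm (e - (cinner e t / cinner t t) *\<^sub>C t))\<^sup>2 =
    (norm e)\<^sup>2 - (cmod (cinner e t))\<^sup>2 / (norm t)\<^sup>2"
proof -
  let ?c = "cinner e t"
  let ?a = "?c / cinner t t"
  have tt: "cinner t t \<noteq> 0" using assms by (simp add: cinner_self_eq_0_iff)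
  have "cinner (e - ?a *\<^sub>C t) t = 0"
    using tt by (simp add: cinner_diff_left cinner_scaleC_left)
  then have "cinner (e - ?a *\<^sub>C t) (e - ?a *\<^sub>C t) = cinner (e - ?a *\<^sub>C t) e"
    by (simp only: cinner_diff_right cinner_scaleC_right) simp
  also have "\<dots> = cinner e e - ?c * cnj ?c / cinner t t"
    by (simp add: cinner_diff_left cinner_scaleC_left cinner_commute[of t e])
  finally have "complex_of_real ((norm (e - ?a *\<^sub>C t))\<^sup>2) =
      complex_of_real ((norm e)\<^sup>2 - (cmod ?c)\<^sup>2 / (norm t)\<^sup>2)"
    by (simp add: cinner_self complex_norm_square[symmetric] del: of_real_power)
  then show ?thesis by (simp only: of_real_eq_iff)
qed

lemma csubspace_diff: "csubspace S \<Longrightarrow> x \<in> S \<Longrightarrow> y \<in> S \<Longrightarrow> x - y \<in> S"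
  by (metis csubspace_def scaleC_of_real scaleR_minus1_left uminus_add_conv_diff add.commute)

lemma csubspace_scaleR: "csubspace S \<Longrightarrow> x \<in> S \<Longrightarrow> r *\<^sub>R x \<in> S"
  by (metis csubspace_def scaleC_of_real)

text \<open>A minimizing sequence is Cauchy by the parallelogram law, since midpoints of points of
  \<open>S\<close> lie in \<open>S\<close>; its limit attains the infimum.\<close>

lemma nearest_point_exists:
  fixes S :: "'a::chilbert_space set"
  assumes sub: "csubspace S" and "closed S"
  obtains s where "s \<in> S" "\<And>t. t \<in> S \<Longrightarrow> (norm (x - s))\<^sup>2 \<le> (norm (x - t))\<^sup>2"
proof -
  define N where "N = (\<lambda>s. (norm (x - s))\<^sup>2) ` S"
  define d where "d = Inf N"
  have ne: "N \<noteq> {}" using sub by (auto simp: N_def csubspace_def)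
  have bdd: "bdd_below N" by (rule bdd_belowI[of _ 0]) (auto simp: N_def)
  have d_le: "d \<le> (norm (x - s))\<^sup>2" if "s \<in> S" for s
    unfolding d_def using that bdd by (intro cInf_lower) (auto simp: N_def)
  have "\<exists>s\<in>S. (norm (x - s))\<^sup>2 < d + 1 / real (Suc n)" for n
  proof -
    have "Inf N < d + 1 / real (Suc n)" by (simp add: d_def)
    then obtain v where "v \<in> N" "v < d + 1 / real (Suc n)" using ne by (metis cInf_lessD)
    then show ?thesis by (auto simp: N_def)
  qed
  then obtain s where s: "\<And>n. s n \<in> S" "\<And>n. (norm (x - s n))\<^sup>2 < d + 1 / real (Suc n)"
    by metis
  have diff: "(norm (s m - s n))\<^sup>2 \<le> 2 / real (Suc m) + 2 / real (Suc n)" for m n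
  proof -
    \<comment> \<open>The sum of \<open>x - s m\<close> and \<open>x - s n\<close> is twice
      \<open>x\<close> minus the midpoint, so its squared norm is at least \<open>4 * d\<close>. The
      parallelogram law then leaves only the excesses over \<open>d\<close> for the
      difference.\<close>
    have mid: "(1 / 2) *\<^sub>R (s m + s n) \<in> S"
      using sub s(1) by (intro csubspace_scaleR) (auto simp: csubspace_def)
    have eq: "(x - s m) + (x - s n) = 2 *\<^sub>R (x - (1 / 2) *\<^sub>R (s m + s n))"
      by (simp add: algebra_simps scaleR_2)
    have "(norm ((x - s m) + (x - s n)))\<^sup>2 = 4 * (norm (x - (1 / 2) *\<^sub>R (s m + s n)))\<^sup>2"
      unfolding eq by (simp add: power_mult_distrib)
    moreover have "norm ((x - s m) - (x - s n)) = norm (s m - s n)"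
      by (simp add: norm_minus_commute)
    ultimately show ?thesis
      using parallelogram_law[of "x - s m" "x - s n"] d_le[OF mid] s(2)[of m] s(2)[of n]
      by simp
  qed
  have "Cauchy s"
  proof (rule metric_CauchyI)
    fix e :: real assume e: "e > 0"
    \<comment> \<open>For \<open>m, n \<ge> M\<close> the bound in \<open>diff\<close> is at most
      \<open>4 / real (Suc M)\<close>, hence the threshold \<open>e\<^sup>2 / 4\<close>.\<close>
    then obtain M where M: "inverse (real (Suc M)) < e\<^sup>2 / 4"
      using reals_Archimedean[of "e\<^sup>2 / 4"] by auto
    have "dist (s m) (s n) < e" if "m \<ge> M" "n \<ge> M" for m n
    proof -
      have "1 / real (Suc m) \<le> 1 / real (Suc M)" "1 / real (Suc n) \<le> 1 / real (Suc M)"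
        using that by (auto intro!: divide_left_mono)
      then have "(norm (s m - s n))\<^sup>2 < e\<^sup>2"
        using diff[of m n] M by (simp add: inverse_eq_divide)
      then show ?thesis using e by (simp add: dist_norm power2_less_imp_less)
    qed
    then show "\<exists>M. \<forall>m\<ge>M. \<forall>n\<ge>M. dist (s m) (s n) < e" by blast
  qed
  then obtain l where l: "s \<longlonglongrightarrow> l" using Cauchy_convergent convergent_def by blast
  have "l \<in> S" using \<open>closed S\<close> s(1) l by (metis closed_sequentially)
  have "(\<lambda>n. (norm (x - s n))\<^sup>2) \<longlonglongrightarrow> (norm (x - l))\<^sup>2"
    by (intro tendsto_intros l)
  moreover have "(\<lambda>n. d + 1 / real (Suc n)) \<longlonglongrightarrow> d + 0"
    by (intro tendsto_add tendsto_const LIMSEQ_Suc lim_1_over_n)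
  ultimately have "(norm (x - l))\<^sup>2 \<le> d + 0"
    by (rule LIMSEQ_le) (intro exI[of _ 0] allI impI less_imp_le s(2))
  then show thesis using that[OF \<open>l \<in> S\<close>] order_trans[OF _ d_le]
    by (simp only: add_0_right)
qed

text \<open>Moving the nearest point \<open>s\<close> by the component of \<open>x - s\<close> along
  \<open>t\<close> stays in \<open>S\<close> and shortens the distance to \<open>x\<close> unless
  that component vanishes.\<close>

lemma orthogonal_projection_exists:
  fixes S :: "'a::chilbert_space set"
  assumes sub: "csubspace S" and cl: "closed S"
  obtains s where "s \<in> S" "\<And>t. t \<in> S \<Longrightarrow> cinner (x - s) t = 0"
proof -
  obtain s where s: "s \<in> S" "\<And>t. t \<in> S \<Longrightarrow> (norm (x - s))\<^sup>2 \<le> (norm (x - t))\<^sup>2"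
    using nearest_point_exists[OF assms, of x] by blast
  have "cinner (x - s) t = 0" if t: "t \<in> S" for t
  proof (cases "t = 0")
    case False
    let ?a = "cinner (x - s) t / cinner t t"
    have "s + ?a *\<^sub>C t \<in> S" using sub s(1) t by (auto simp: csubspace_def)
    then have "(norm (x - s))\<^sup>2 \<le> (norm (x - s - ?a *\<^sub>C t))\<^sup>2"
      using s(2) by (metis diff_diff_eq)
    then have "(cmod (cinner (x - s) t))\<^sup>2 / (norm t)\<^sup>2 \<le> 0"
      unfolding norm_diff_projection_square[OF False] by simp
    then show ?thesis using False by (simp add: divide_le_0_iff)
  qed simp
  then show thesis using that s(1) by blast
qed

text \<open>The residual \<open>x - s\<close> of the projection of \<open>x\<close> is orthogonal to
  \<open>S\<close>, hence zero.\<close>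

lemma closed_csubspace_eq_UNIV:
  fixes S :: "'a::chilbert_space set"
  assumes "csubspace S" and "closed S"
    and "\<And>g. (\<And>s. s \<in> S \<Longrightarrow> cinner g s = 0) \<Longrightarrow> g = 0"
  shows "S = UNIV"
proof -
  have "x \<in> S" for x
  proof -
    obtain s where "s \<in> S" "\<And>t. t \<in> S \<Longrightarrow> cinner (x - s) t = 0"
      using orthogonal_projection_exists[OF assms(1,2)] by blast
    then show ?thesis using assms(3)[of "x - s"] by simp
  qed
  then show ?thesis by auto
qed

section \<open>Lagrangian subsets and unitary operators\<close>

text \<open>Cauchy-Schwarz makes the map bounded; the inequality is read off from
  \<open>norm_diff_projection_square\<close>, whose left-hand side is nonnegative.\<close>

lemma continuous_on_cinner_left: "continuous_on UNIV (\<lambda>x. cinner x y)"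
  for y :: "'a::chilbert_space"
proof -
  have "norm (cinner x y) \<le> norm x * norm y" for x
  proof (cases "y = 0")
    case False
    have "(cmod (cinner x y))\<^sup>2 / (norm y)\<^sup>2 \<le> (norm x)\<^sup>2"
      using norm_diff_projection_square[OF False, of x]
        zero_le_power2[of "norm (x - (cinner x y / cinner y y) *\<^sub>C y)"] by linarith
    then have "(cmod (cinner x y))\<^sup>2 \<le> (norm x * norm y)\<^sup>2"
      using False by (simp add: divide_le_eq power_mult_distrib)
    then show ?thesis by (rule power2_le_imp_le) simp
  qed simp
  then have "bounded_linear (\<lambda>x. cinner x y)"
    by (intro bounded_linear_intro[where K = "norm y"])
      (simp_all add: cinner_add_left cinner_scaleR_left scaleR_conv_of_real)
  then show ?thesis by (simp add: linear_continuous_on)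
qed

text \<open>Only equality with the own \<omega>-complement is demanded: that \<open>R\<close> is a
  closed subspace follows from it.\<close>

definition lagrangian :: "('a::chilbert_space \<times> 'b::chilbert_space) set \<Rightarrow> bool" where
  "lagrangian R \<longleftrightarrow> R = {p. \<forall>q\<in>R. standard_unitary_form p q = 0}"

lemma lagrangian_iff:
  "lagrangian R \<Longrightarrow> p \<in> R \<longleftrightarrow> (\<forall>q\<in>R. standard_unitary_form p q = 0)"
  unfolding lagrangian_def by blast

text \<open>The form is Hermitian: exchanging the arguments conjugates its value.\<close>

lemma standard_unitary_form_eq_0_commute:
  "standard_unitary_form p q = 0 \<longleftrightarrow> standard_unitary_form q p = 0"
  unfolding standard_unitary_form_def eq_iff_diff_eq_0[symmetric]
  by (metis cinner_commute)

lemma standard_unitary_form_swap: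
  "standard_unitary_form (prod.swap p) (prod.swap q) = - standard_unitary_form p q"
  by (simp add: standard_unitary_form_def)

text \<open>Exchanging the factors only changes the sign of the form, so complements are preserved.
  Results on first components thereby carry over to second components.\<close>

lemma lagrangian_swap:
  fixes R :: "('a::chilbert_space \<times> 'b::chilbert_space) set"
  assumes "lagrangian R"
  shows "lagrangian (prod.swap ` R)"
proof -
  have "p \<in> prod.swap ` R \<longleftrightarrow> (\<forall>q\<in>prod.swap ` R. standard_unitary_form p q = 0)" for p
  proof -
    have "p \<in> prod.swap ` R \<longleftrightarrow> prod.swap p \<in> R"
      by (metis (no_types, lifting) image_iff swap_swap)
    also have "\<dots> \<longleftrightarrow> (\<forall>q\<in>R. standard_unitary_form (prod.swap p) q = 0)"
      by (rule lagrangian_iff[OF assms])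
    also have "\<dots> \<longleftrightarrow> (\<forall>q\<in>prod.swap ` R. standard_unitary_form p q = 0)"
      using standard_unitary_form_swap[of "prod.swap p"] by simp
    finally show ?thesis .
  qed
  then show ?thesis unfolding lagrangian_def by blast
qed

lemma csubspace_lagrangian:
  assumes "lagrangian R"
  shows "csubspace R"
proof -
  have "csubspace {p. \<forall>q\<in>R. standard_unitary_form p q = 0}"
    by (auto simp: csubspace_def standard_unitary_form_def scaleC_prod_def cinner_add_left
        cinner_scaleC_left)
  \<comment> \<open>\<open>R\<close> occurs on both sides of its defining equation, so rewriting
    with it would loop; a single explicit substitution avoids this.\<close>
  then show ?thesis by (rule ssubst[where P = csubspace, OF assms[unfolded lagrangian_def]])
qed

text \<open>A complement is an intersection of zero sets of continuous functions.\<close>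

lemma closed_lagrangian:
  fixes R :: "('a::chilbert_space \<times> 'b::chilbert_space) set"
  assumes "lagrangian R"
  shows "closed R"
proof -
  have "R = (\<Inter>q\<in>R. {p. standard_unitary_form p q = 0})"
    using lagrangian_iff[OF assms] by blast
  moreover have "closed {p. standard_unitary_form p q = 0}" for q :: "'a \<times> 'b"
    unfolding standard_unitary_form_def
    by (intro closed_Collect_eq continuous_intros
        continuous_on_compose2[OF continuous_on_cinner_left]) auto
  ultimately show ?thesis by (metis closed_INT)
qed

lemma lagrangian_cinner_eq:
  assumes "lagrangian R" "(a, b) \<in> R" "(c, d) \<in> R"
  shows "cinner a c = cinner b d"
proof -
  have "standard_unitary_form (a, b) (c, d) = 0" using assms lagrangian_iff by blast
  then show ?thesis by (simp add: standard_unitary_form_def)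
qed

lemma lagrangian_norm_eq:
  assumes "lagrangian R" "(a, b) \<in> R"
  shows "norm a = norm b"
proof -
  have "complex_of_real ((norm a)\<^sup>2) = complex_of_real ((norm b)\<^sup>2)"
    using lagrangian_cinner_eq[OF assms assms(2)] by (simp only: cinner_self)
  then show ?thesis by (simp only: of_real_eq_iff) simp
qed

section \<open>Lagrangian sets are the graphs of unitary operators\<close>

lemma lagrangian_fst_UNIV:
  fixes R :: "('a::chilbert_space \<times> 'b::chilbert_space) set"
  assumes R: "lagrangian R"
  shows "fst ` R = UNIV"
proof (rule closed_csubspace_eq_UNIV)
  note sub = csubspace_lagrangian[OF R]
  show "csubspace (fst ` R)"
    unfolding csubspace_def
  proof (intro conjI ballI allI)
    show "0 \<in> fst ` R" using sub by (force simp: csubspace_def)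
    fix x a assume "x \<in> fst ` R"
    then obtain p where p: "p \<in> R" "x = fst p" by blast
    then have "a *\<^sub>C p \<in> R" using sub by (simp add: csubspace_def)
    then show "a *\<^sub>C x \<in> fst ` R" using p(2) by (force simp: scaleC_prod_def)
    fix y assume "y \<in> fst ` R"
    then obtain q where q: "q \<in> R" "y = fst q" by blast
    then have "p + q \<in> R" using p sub by (simp add: csubspace_def)
    then show "x + y \<in> fst ` R" using p(2) q(2) by force
  qed
  show "closed (fst ` R)"
    unfolding closed_sequential_limits
  proof (intro allI impI, elim conjE)
    fix x l assume x: "\<forall>n. x n \<in> fst ` R" and l: "x \<longlonglongrightarrow> l"
    have "\<forall>n. \<exists>b. (x n, b) \<in> R" using x by force
    then obtain y where y: "\<And>n. (x n, y n) \<in> R" by metis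
    \<comment> \<open>Differences of elements of \<open>R\<close> lie in \<open>R\<close> and so
      have components of equal norm. Convergence of the first components therefore makes the second
      ones Cauchy.\<close>
    have "dist (y m) (y n) = dist (x m) (x n)" for m n
      using csubspace_diff[OF sub y y, of m n] lagrangian_norm_eq[OF R]
      by (simp add: dist_norm)
    then have "Cauchy y"
      using LIMSEQ_imp_Cauchy[OF l] by (simp add: Cauchy_def)
    then obtain k where "y \<longlonglongrightarrow> k" using Cauchy_convergent convergent_def by blast
    then have "(\<lambda>n. (x n, y n)) \<longlonglongrightarrow> (l, k)" using l by (intro tendsto_Pair)
    then have "(l, k) \<in> R"
      using closed_sequentially[OF closed_lagrangian[OF R], of "\<lambda>n. (x n, y n)"] y by simp
    then show "l \<in> fst ` R" by force
  qed
  fix g assume g: "\<And>s. s \<in> fst ` R \<Longrightarrow> cinner g s = 0"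
  \<comment> \<open>A vector \<open>g\<close> orthogonal to all first components makes
    \<open>(g, 0)\<close> \<omega>-orthogonal to \<open>R\<close>, hence a member of
    \<open>R\<close>, and equality of norms gives \<open>g = 0\<close>.\<close>
  have "(g, 0) \<in> R"
    unfolding lagrangian_iff[OF R] using g by (auto simp: standard_unitary_form_def)
  from lagrangian_norm_eq[OF R this] show "g = 0" by simp
qed

lemma lagrangian_snd_UNIV:
  fixes R :: "('a::chilbert_space \<times> 'b::chilbert_space) set"
  assumes "lagrangian R"
  shows "snd ` R = UNIV"
  using lagrangian_fst_UNIV[OF lagrangian_swap[OF assms]] by (simp add: image_image)

text \<open>Two values at one point would put \<open>(0, b - c)\<close> in \<open>R\<close>, which
  forces \<open>b = c\<close>. The projections make \<open>L\<close> total and surjective, the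
  subspace property makes it linear, and vanishing of \<omega> on \<open>R\<close> makes it
  isometric.\<close>

lemma lagrangian_graph_unitary:
  fixes R :: "('a::chilbert_space \<times> 'b::chilbert_space) set"
  assumes R: "lagrangian R"
  obtains L where "L \<in> unitary_operators" "R = {p. L (fst p) = snd p}"
proof -
  note sub = csubspace_lagrangian[OF R]
  have uniq: "b = c" if "(a, b) \<in> R" "(a, c) \<in> R" for a b c
    using lagrangian_norm_eq[OF R, of "0" "b - c"] csubspace_diff[OF sub that] by simp
  have "\<forall>a. \<exists>b. (a, b) \<in> R"
  proof
    fix a
    have "a \<in> fst ` R" using lagrangian_fst_UNIV[OF R] by simp
    then show "\<exists>b. (a, b) \<in> R" by force
  qed
  from choice[OF this] obtain L where L: "(a, L a) \<in> R" for a by auto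
  have graph: "R = {p. L (fst p) = snd p}"
  proof (intro set_eqI iffI CollectI)
    show "L (fst p) = snd p" if "p \<in> R" for p
      using uniq[OF L, of "fst p"] that by simp
    show "p \<in> R" if "p \<in> {p. L (fst p) = snd p}" for p
      using L[of "fst p"] that by simp
  qed
  have "clinear_on UNIV L"
    unfolding clinear_on_def
  proof (intro conjI ballI allI)
    show "csubspace (UNIV :: 'a set)" by (simp add: csubspace_def)
    show "L (x + y) = L x + L y" for x y
    proof -
      have "(x, L x) + (y, L y) \<in> R" using sub L unfolding csubspace_def by blast
      then show ?thesis by (simp add: graph)
    qed
    show "L (a *\<^sub>C x) = a *\<^sub>C L x" for a x
    proof -
      have "a *\<^sub>C (x, L x) \<in> R" using sub L unfolding csubspace_def by blast
      then show ?thesis by (simp add: graph scaleC_prod_def)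
    qed
  qed
  moreover have "surj L"
  unfolding surj_def
  proof
    fix b
    have "b \<in> snd ` R" using lagrangian_snd_UNIV[OF R] by simp
    then obtain a where "(a, b) \<in> R" by force
    then show "\<exists>a. b = L a" by (auto simp: graph)
  qed
  moreover have "cinner (L x) (L y) = cinner x y" for x y
    using lagrangian_cinner_eq[OF R L L] by simp
  ultimately have "L \<in> unitary_operators" by (simp add: unitary_operators_def)
  then show thesis using graph that by blast
qed

text \<open>Isometry makes the graph \<omega>-orthogonal to itself. Conversely, if
  \<open>(a, b)\<close> is \<omega>-orthogonal to the graph, then \<open>L a - b\<close> is
  orthogonal to the range of \<open>L\<close>, which is the whole space.\<close>

lemma unitary_graph_lagrangian:
  assumes "L \<in> unitary_operators"
  shows "lagrangian {p. L (fst p) = snd p}"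
proof -
  have inner: "cinner (L x) (L y) = cinner x y" for x y
    using assms by (simp add: unitary_operators_def)
  have "L a = b" if orth: "\<And>g. standard_unitary_form (a, b) (g, L g) = 0" for a b
  proof -
    have "cinner (L a - b) (L g) = 0" for g
      using orth[of g] inner[of a g] by (simp add: standard_unitary_form_def cinner_diff_left)
    moreover have "surj L" using assms by (simp add: unitary_operators_def)
    ultimately have "cinner (L a - b) (L a - b) = 0" by (metis surjD)
    then show ?thesis by (simp add: cinner_self_eq_0_iff)
  qed
  then show ?thesis unfolding lagrangian_def
    by (auto simp: standard_unitary_form_def inner)
qed

lemma unitary_operators_linear:
  assumes "L \<in> unitary_operators"
  shows "L (x + y) = L x + L y" "L (r *\<^sub>R x) = r *\<^sub>R L x"
proof -
  show "L (x + y) = L x + L y"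
    using assms unfolding unitary_operators_def clinear_on_def by blast
  have "L (complex_of_real r *\<^sub>C x) = complex_of_real r *\<^sub>C L x"
    using assms unfolding unitary_operators_def clinear_on_def by blast
  then show "L (r *\<^sub>R x) = r *\<^sub>R L x" unfolding scaleC_of_real .
qed

text \<open>The difference of two graph points lies in the graph, where both components have equal
  norm.\<close>

lemma unitary_operators_inj:
  assumes "L \<in> unitary_operators"
  shows "inj L"
proof (rule injI)
  fix x y assume eq: "L x = L y"
  have "(x, L x) - (y, L y) \<in> {p. L (fst p) = snd p}"
    by (intro csubspace_diff csubspace_lagrangian unitary_graph_lagrangian assms) simp_all
  then have "norm (x - y) = norm (L x - L y)"
    by (intro lagrangian_norm_eq[OF unitary_graph_lagrangian[OF assms]]) simp
  then show "x = y" using eq by simp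
qed

section \<open>Skew-self-adjoint restrictions of the adjoint\<close>

text \<open>An arbitrary set \<open>R\<close> of boundary values is allowed, so that restrictions
  not yet known to come from an operator fit the same form. Points outside the domain of the adjoint
  may satisfy the membership condition by accident, but the map is \<open>None\<close> there
  anyway.\<close>

definition boundary_restriction ::
    "('h::chilbert_space \<rightharpoonup> 'h) \<Rightarrow> ('h \<times> 'h \<Rightarrow> 'g) \<Rightarrow> 'g set \<Rightarrow> ('h \<rightharpoonup> 'h)" where
  "boundary_restriction H0 F R = op_adjoint H0 |` {x. F (x, the (op_adjoint H0 x)) \<in> R}"

lemma system_restriction_eq_boundary_restriction:
  "system_restriction H0 F L = boundary_restriction H0 F {p. L (fst p) = snd p}"
  unfolding system_restriction_def boundary_restriction_def boundary_comp1_def boundary_comp2_def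
  by (rule ext) (simp add: restrict_map_def domIff)

locale unitary_boundary_system =
  fixes H0 :: "'h::chilbert_space \<rightharpoonup> 'h"
    and F :: "'h \<times> 'h \<Rightarrow> 'g1::chilbert_space \<times> 'g2::chilbert_space"
  assumes dense: "densely_defined H0"
    and skew: "skew_symmetric H0"
    and system: "boundary_system H0 standard_symmetric_form F standard_unitary_form"
begin

abbreviation A where "A x \<equiv> the (op_adjoint H0 x)"
abbreviation D where "D \<equiv> dom (op_adjoint H0)"
abbreviation f where "f x \<equiv> F (x, A x)"

lemma dense_dom: "closure (dom H0) = UNIV"
  using dense by (simp add: densely_defined_def)

lemma green:
  "x \<in> D \<Longrightarrow> y \<in> D \<Longrightarrow> cinner x (A y) + cinner (A x) y = standard_unitary_form (f x) (f y)"
  using system by (simp add: boundary_system_def standard_symmetric_form_def)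

lemma boundary_value_exists: obtains x where "x \<in> D" "f x = p"
proof -
  have "p \<in> F ` Map.graph (op_adjoint H0)" using system by (simp add: boundary_system_def)
  then obtain x z where "op_adjoint H0 x = Some z" "F (x, z) = p"
    by (auto simp: Map.graph_def)
  then show thesis using that[of x] by auto
qed

lemma adjoint_of_symmetric:
  assumes "x \<in> dom H0"
  shows "x \<in> D" "A x = - the (H0 x)"
proof -
  have "H0 x = op_neg (op_adjoint H0) x"
    using skew assms by (simp add: skew_symmetric_def map_le_def)
  then show "x \<in> D" "A x = - the (H0 x)"
    using assms by (auto simp: op_neg_def dom_def)
qed

lemma adjointI:
  assumes "\<And>x. x \<in> dom H0 \<Longrightarrow> cinner (the (H0 x)) y = cinner x z"
  shows "y \<in> D" "A y = z"
  using assms op_adjoint_eq_Some_iff[OF dense_dom, of y z] by auto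

lemma adjointD:
  "y \<in> D \<Longrightarrow> x \<in> dom H0 \<Longrightarrow> cinner (the (H0 x)) y = cinner x (A y)"
  using op_adjoint_eq_Some_iff[OF dense_dom, of y "A y"] by auto

text \<open>Since \<open>A x = - the (H0 x)\<close>, the definition of the adjoint makes the
  left-hand side of Green's identity vanish for every \<open>y \<in> D\<close>. As \<open>f\<close>
  is surjective, \<open>f x\<close> is \<omega>-orthogonal to everything.\<close>

lemma boundary_value_symmetric:
  assumes x: "x \<in> dom H0"
  shows "f x = 0"
proof (rule standard_unitary_form_nondegenerate)
  fix q
  obtain y where y: "y \<in> D" "f y = q" by (rule boundary_value_exists)
  show "standard_unitary_form (f x) q = 0"
    using green[OF adjoint_of_symmetric(1)[OF x] y(1)] adjointD[OF y(1) x]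
    by (simp add: adjoint_of_symmetric(2)[OF x] cinner_minus_left y(2))
qed

lemma linear_on_D:
  shows "csubspace D" "clinear_on D A" "clinear_on D f"
  using linear_operator_op_adjoint[OF dense_dom] boundary_system_clinear[OF dense_dom system]
  by (simp_all add: linear_operator_def clinear_on_def)

lemma dom_boundary_restriction: "dom (boundary_restriction H0 F R) = {x \<in> D. f x \<in> R}"
  by (auto simp: boundary_restriction_def)

lemma boundary_restriction_apply:
  "f x \<in> R \<Longrightarrow> boundary_restriction H0 F R x = op_adjoint H0 x"
  by (simp add: boundary_restriction_def)

text \<open>Boundary values vanish on \<open>dom H0\<close> and \<open>0 \<in> R\<close>, so the
  domain contains a dense set; linearity is inherited from \<open>A\<close> and
  \<open>f\<close>.\<close>

lemma densely_defined_boundary_restriction: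
  assumes R: "csubspace R"
  shows "densely_defined (boundary_restriction H0 F R)"
proof -
  let ?E = "{x \<in> D. f x \<in> R}"
  have "dom H0 \<subseteq> ?E"
    using R adjoint_of_symmetric(1) boundary_value_symmetric
    unfolding csubspace_def by (metis (mono_tags, lifting) mem_Collect_eq subsetI)
  then have "closure ?E = UNIV" using dense_dom closure_mono by blast
  moreover have "csubspace ?E"
  proof -
    have "f 0 = 0"
      using linear_on_D(1,3)
      by (metis (no_types, lifting) add_cancel_left_left add.right_neutral clinear_on_def csubspace_def)
    then show ?thesis
      using R linear_on_D(1,3) unfolding csubspace_def clinear_on_def by auto
  qed
  moreover have "clinear_on ?E (\<lambda>x. the (boundary_restriction H0 F R x))"
    using linear_on_D(2) \<open>csubspace ?E\<close>
    by (auto simp: clinear_on_def csubspace_def boundary_restriction_apply)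
  ultimately show ?thesis
    unfolding densely_defined_def linear_operator_def dom_boundary_restriction by blast
qed

text \<open>By Green's identity, \<open>- A y\<close> is a value of the adjoint of the restriction
  at \<open>y\<close> exactly when \<open>f y\<close> is \<omega>-orthogonal to \<open>R\<close>,
  that is, when \<open>f y \<in> R\<close>.\<close>

lemma skew_self_adjoint_boundary_restriction:
  assumes R: "lagrangian R"
  shows "skew_self_adjoint (boundary_restriction H0 F R)"
proof -
  let ?H = "boundary_restriction H0 F R"
  have dd: "densely_defined ?H"
    using densely_defined_boundary_restriction csubspace_lagrangian[OF R] by blast
  have "op_adjoint ?H y = Some z \<longleftrightarrow> ?H y = Some (- z)" for y z
  proof
    assume adj: "op_adjoint ?H y = Some z"
    then have adj: "cinner (A x) y = cinner x z" if "x \<in> D" "f x \<in> R" for x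
      using dd that op_adjoint_eq_Some_iff[of ?H y z]
      by (auto simp: densely_defined_def dom_boundary_restriction boundary_restriction_apply)
    \<comment> \<open>Testing only with \<open>x \<in> dom H0\<close>, where \<open>A\<close> is the
      negative of \<open>H0\<close>, already places \<open>y\<close> in the domain of the adjoint of
      \<open>H0\<close>.\<close>
    have y: "y \<in> D" "A y = - z"
    proof -
      have "cinner (the (H0 x)) y = cinner x (- z)" if x: "x \<in> dom H0" for x
        using adj[of x] adjoint_of_symmetric[OF x] boundary_value_symmetric[OF x]
          csubspace_lagrangian[OF R]
        by (simp add: csubspace_def cinner_minus_left cinner_minus_right minus_equation_iff)
      then show "y \<in> D" "A y = - z" using adjointI by blast+
    qed
    have "f y \<in> R"
      unfolding lagrangian_iff[OF R]
    proof
      fix q assume q: "q \<in> R"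
      \<comment> \<open>By surjectivity \<open>q\<close> is the boundary value of some
        \<open>x\<close>, and this \<open>x\<close> lies in the domain of the restriction because
        \<open>q \<in> R\<close>.\<close>
      obtain x where x: "x \<in> D" "f x = q" by (rule boundary_value_exists)
      have "standard_unitary_form q (f y) = 0"
        using green[OF x(1) y(1)] adj[of x] x q y(2) by (simp add: cinner_minus_right)
      then show "standard_unitary_form (f y) q = 0"
        by (simp only: standard_unitary_form_eq_0_commute)
    qed
    then show "?H y = Some (- z)" using y by (auto simp: boundary_restriction_apply)
  next
    assume "?H y = Some (- z)"
    then have y: "y \<in> D" "f y \<in> R" "A y = - z"
      by (auto simp: boundary_restriction_def restrict_map_def split: if_splits)
    have "cinner (A x) y = cinner x z" if "x \<in> D" "f x \<in> R" for x
    proof -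
      have "standard_unitary_form (f x) (f y) = 0" using lagrangian_iff[OF R] that y(2) by blast
      then show ?thesis using green[OF that(1) y(1)] y(3) by (simp add: cinner_minus_right)
    qed
    then show "op_adjoint ?H y = Some z"
      using dd op_adjoint_eq_Some_iff[of ?H y z]
      by (auto simp: densely_defined_def dom_boundary_restriction boundary_restriction_apply)
  qed
  then have "?H y = op_neg (op_adjoint ?H) y" for y
    unfolding op_neg_def
    by (metis map_option_eq_Some minus_minus not_Some_eq)
  then show ?thesis using dd by (auto simp: skew_self_adjoint_def)
qed

lemma boundary_restriction_le: "boundary_restriction H0 F R \<subseteq>\<^sub>m op_adjoint H0"
  unfolding map_le_def dom_boundary_restriction by (simp add: boundary_restriction_apply)

text \<open>Take for \<open>R\<close> the boundary values attained on \<open>dom H\<close>. Nothing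
  is lost: Green's identity and skew-self-adjointness show that membership of \<open>y\<close> in
  \<open>dom H\<close> depends on \<open>f y\<close> alone.\<close>

lemma skew_self_adjoint_restrictionE:
  assumes H: "skew_self_adjoint H" "H \<subseteq>\<^sub>m op_adjoint H0"
  obtains R where "lagrangian R" "H = boundary_restriction H0 F R"
proof -
  define R where "R = f ` dom H"
  have dense_H: "closure (dom H) = UNIV" and H_eq: "H = op_neg (op_adjoint H)"
    using H(1) by (simp_all add: skew_self_adjoint_def densely_defined_def)
  have sub: "x \<in> D" and H_A: "H x = op_adjoint H0 x" if "x \<in> dom H" for x
    using H(2) that by (auto simp: map_le_def dom_def)
  have mem_iff: "y \<in> dom H \<longleftrightarrow> (\<forall>q\<in>R. standard_unitary_form (f y) q = 0)" if y: "y \<in> D" for y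
  proof
    assume yH: "y \<in> dom H"
    then obtain z where z: "op_adjoint H y = Some z" "H y = Some (- z)"
      using H_eq by (metis (no_types, lifting) domD map_option_eq_Some op_neg_def)
    show "\<forall>q\<in>R. standard_unitary_form (f y) q = 0"
      unfolding R_def
    proof (intro ballI, elim imageE)
      fix q x assume x: "x \<in> dom H" and q: "q = f x"
      have "cinner (A x) y = cinner x z"
        using z(1) x op_adjoint_eq_Some_iff[OF dense_H] by (simp flip: H_A[OF x])
      then have "standard_unitary_form (f x) (f y) = 0"
        using green[OF sub[OF x] y] z(2) by (simp add: cinner_minus_right flip: H_A[OF yH])
      then show "standard_unitary_form (f y) q = 0"
        unfolding q by (simp only: standard_unitary_form_eq_0_commute)
    qed
  next
    assume orth: "\<forall>q\<in>R. standard_unitary_form (f y) q = 0"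
    \<comment> \<open>Orthogonality to \<open>R\<close> kills the boundary term in Green's identity,
      so \<open>y\<close> is in the domain of the adjoint of \<open>H\<close>, which equals
      \<open>dom H\<close>.\<close>
    have "op_adjoint H y = Some (- A y)"
      unfolding op_adjoint_eq_Some_iff[OF dense_H]
    proof
      fix x assume x: "x \<in> dom H"
      have "standard_unitary_form (f y) (f x) = 0" using orth x by (simp add: R_def)
      then have "standard_unitary_form (f x) (f y) = 0"
        by (simp only: standard_unitary_form_eq_0_commute)
      then show "cinner (the (H x)) y = cinner x (- A y)"
        using green[OF sub[OF x] y]
        by (simp add: H_A[OF x] cinner_minus_right add_eq_0_iff)
    qed
    then show "y \<in> dom H" by (subst H_eq) auto
  qed
  have "lagrangian R"
    unfolding lagrangian_def
  proof (intro set_eqI iffI CollectI)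
    fix p assume "p \<in> R"
    then show "\<forall>q\<in>R. standard_unitary_form p q = 0"
      using mem_iff[OF sub] unfolding R_def by blast
  next
    fix p assume p: "p \<in> {p. \<forall>q\<in>R. standard_unitary_form p q = 0}"
    \<comment> \<open>Surjectivity of \<open>f\<close> turns the statement on \<open>D\<close> in
      \<open>mem_iff\<close> into one on all of the boundary space.\<close>
    obtain y where "y \<in> D" "f y = p" by (rule boundary_value_exists)
    then show "p \<in> R" using p mem_iff[of y] unfolding R_def by blast
  qed
  moreover have "H = boundary_restriction H0 F R"
  proof
    fix x
    have "x \<in> dom H \<longleftrightarrow> x \<in> D \<and> f x \<in> R"
      using mem_iff sub lagrangian_iff[OF \<open>lagrangian R\<close>] by blast
    then show "H x = boundary_restriction H0 F R x"
      by (metis (no_types, lifting) H_A boundary_restriction_apply dom_boundary_restriction domIff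
          mem_Collect_eq)
  qed
  ultimately show thesis using that by blast
qed

text \<open>Surjectivity of \<open>f\<close> makes a set of boundary values recoverable from its
  preimage in \<open>D\<close>.\<close>

lemma boundary_restriction_inj:
  assumes "boundary_restriction H0 F R = boundary_restriction H0 F S"
  shows "R = S"
proof -
  have "{x \<in> D. f x \<in> R} = {x \<in> D. f x \<in> S}"
    unfolding dom_boundary_restriction[symmetric] assms ..
  then have dom_iff: "f x \<in> R \<longleftrightarrow> f x \<in> S" if "x \<in> D" for x
    using that by blast
  have "p \<in> R \<longleftrightarrow> p \<in> S" for p
  proof -
    obtain x where "x \<in> D" "f x = p" by (rule boundary_value_exists)
    then show ?thesis using dom_iff[of x] by simp
  qed
  then show ?thesis by (rule set_eqI)
qed

lemma bij_betw_system_restriction: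
  "bij_betw (system_restriction H0 F) unitary_operators
     {H. skew_self_adjoint H \<and> H \<subseteq>\<^sub>m op_adjoint H0}"
  unfolding bij_betw_def
proof
  show "inj_on (system_restriction H0 F) unitary_operators"
  proof (rule inj_onI)
    fix L M assume "system_restriction H0 F L = system_restriction H0 F M"
    then have eq: "{p. L (fst p) = snd p} = {p. M (fst p) = snd p}"
      unfolding system_restriction_eq_boundary_restriction by (rule boundary_restriction_inj)
    have "(g, L g) \<in> {p. M (fst p) = snd p}" for g unfolding eq[symmetric] by simp
    then show "L = M" by (simp add: ext)
  qed
  show "system_restriction H0 F ` unitary_operators =
      {H. skew_self_adjoint H \<and> H \<subseteq>\<^sub>m op_adjoint H0}"
  proof (intro equalityI subsetI)
    fix H assume "H \<in> system_restriction H0 F ` unitary_operators"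
    then show "H \<in> {H. skew_self_adjoint H \<and> H \<subseteq>\<^sub>m op_adjoint H0}"
      by (auto simp: system_restriction_eq_boundary_restriction boundary_restriction_le
          intro!: skew_self_adjoint_boundary_restriction unitary_graph_lagrangian)
  next
    fix H assume "H \<in> {H. skew_self_adjoint H \<and> H \<subseteq>\<^sub>m op_adjoint H0}"
    then obtain R where R: "lagrangian R" "H = boundary_restriction H0 F R"
      using skew_self_adjoint_restrictionE by blast
    obtain L where "L \<in> unitary_operators" "R = {p. L (fst p) = snd p}"
      using lagrangian_graph_unitary[OF R(1)] .
    then show "H \<in> system_restriction H0 F ` unitary_operators"
      using R(2) by (auto simp: system_restriction_eq_boundary_restriction)
  qed
qed

end

section \<open>Comparison with the map of the boundary triplet\<close>

text \<open>The condition of the triplet regroups to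
  \<open>M (\<Gamma>1 x + \<Gamma>2 x) = \<Gamma>1 x - \<Gamma>2 x\<close>, where the sum is a
  multiple of the first boundary component and the difference the same multiple of
  \<open>inv L0\<close> of the second. The outer negation cancels the one in
  \<open>triplet_extension\<close>.\<close>

lemma system_restriction_eq_triplet_extension:
  fixes H0 :: "'h::chilbert_space \<rightharpoonup> 'h"
    and F :: "'h \<times> 'h \<Rightarrow> 'g1::chilbert_space \<times> 'g2::chilbert_space"
  assumes L0: "L0 \<in> unitary_operators" and L: "L \<in> unitary_operators"
    and \<Gamma>1: "\<And>x. x \<in> dom (op_adjoint H0) \<Longrightarrow>
      \<Gamma>1 x = (1 / sqrt 2) *\<^sub>R (boundary_comp1 H0 F x + inv L0 (boundary_comp2 H0 F x))"
    and \<Gamma>2: "\<And>x. x \<in> dom (op_adjoint H0) \<Longrightarrow>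
      \<Gamma>2 x = (1 / sqrt 2) *\<^sub>R (boundary_comp1 H0 F x - inv L0 (boundary_comp2 H0 F x))"
  shows "system_restriction H0 F L = op_neg (triplet_extension H0 \<Gamma>1 \<Gamma>2 (inv L0 \<circ> L))"
proof -
  define M where "M = inv L0 \<circ> L"
  have "surj L0" using L0 unfolding unitary_operators_def by blast
  then have L0_inv: "L0 (inv L0 h) = h" for h by (rule surj_f_inv_f)
  have L0_eq: "L0 g = L0 h \<longleftrightarrow> g = h" for g h
    by (rule inj_eq[OF unitary_operators_inj[OF L0]])
  have L0_M: "L0 (M x) = L x" for x by (simp only: M_def o_def L0_inv)
  \<comment> \<open>Both identities are checked after applying the injective \<open>L0\<close>,
    which turns \<open>M\<close> into \<open>L\<close>.\<close>
  have M_lin: "M (x + y) = M x + M y" "M (r *\<^sub>R x) = r *\<^sub>R M x" for x y r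
    unfolding L0_eq[symmetric] unitary_operators_linear[OF L0] L0_M
    by (rule unitary_operators_linear[OF L])+
  have condition: "M (\<Gamma>1 x) - \<Gamma>1 x + (M (\<Gamma>2 x) + \<Gamma>2 x) = 0 \<longleftrightarrow>
      L (boundary_comp1 H0 F x) = boundary_comp2 H0 F x"
    if x: "x \<in> dom (op_adjoint H0)" for x
  proof -
    define u v where "u = boundary_comp1 H0 F x" and "v = inv L0 (boundary_comp2 H0 F x)"
    define r where "r = 1 / sqrt 2"
    have sum: "\<Gamma>1 x + \<Gamma>2 x = (2 * r) *\<^sub>R u" and diff: "\<Gamma>1 x - \<Gamma>2 x = (2 * r) *\<^sub>R v"
      unfolding \<Gamma>1[OF x] \<Gamma>2[OF x] u_def[symmetric] v_def[symmetric] r_def[symmetric]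
      by (simp_all only: mult_2 scaleR_add_left scaleR_add_right scaleR_diff_right) simp_all
    have "M (\<Gamma>1 x) - \<Gamma>1 x + (M (\<Gamma>2 x) + \<Gamma>2 x) = M (\<Gamma>1 x + \<Gamma>2 x) - (\<Gamma>1 x - \<Gamma>2 x)"
      by (simp add: M_lin)
    also have "\<dots> = (2 * r) *\<^sub>R (M u - v)"
      unfolding sum diff M_lin by (simp add: algebra_simps)
    finally have "M (\<Gamma>1 x) - \<Gamma>1 x + (M (\<Gamma>2 x) + \<Gamma>2 x) = 0 \<longleftrightarrow> M u = v"
      \<comment> \<open>The factor \<open>2 * r\<close>, equal to \<open>sqrt 2\<close>, is nonzero
        and can be cancelled.\<close>
      by (simp add: r_def)
    also have "\<dots> \<longleftrightarrow> L u = boundary_comp2 H0 F x"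
      unfolding L0_eq[symmetric] L0_M v_def L0_inv ..
    finally show ?thesis unfolding u_def .
  qed
  show ?thesis
    unfolding M_def[symmetric]
  proof
    fix x
    show "system_restriction H0 F L x = op_neg (triplet_extension H0 \<Gamma>1 \<Gamma>2 M) x"
    proof (cases "op_adjoint H0 x")
      case None
      then show ?thesis
        by (simp add: system_restriction_def triplet_extension_def op_neg_def restrict_map_def)
    next
      case (Some z)
      then have "x \<in> dom (op_adjoint H0)" by blast
      from condition[OF this] Some show ?thesis
        by (auto simp: system_restriction_def triplet_extension_def op_neg_def restrict_map_def)
    qed
  qed
qed

theorem theorem3:
  fixes H0 :: "'h::chilbert_space \<rightharpoonup> 'h"
    and F :: "'h \<times> 'h \<Rightarrow> 'g1::chilbert_space \<times> 'g2::chilbert_space"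
    and L0 :: "'g1 \<Rightarrow> 'g2"
    and \<Gamma>1 \<Gamma>2 :: "'h \<Rightarrow> 'g1"
  assumes "densely_defined H0"
    and "closed_operator H0"
    and "skew_symmetric H0"
    and "boundary_system H0 standard_symmetric_form F standard_unitary_form"
    and "L0 \<in> unitary_operators"
    and "\<And>x. x \<in> dom (op_adjoint H0) \<Longrightarrow>
      \<Gamma>1 x = (1 / sqrt 2) *\<^sub>R (boundary_comp1 H0 F x + inv L0 (boundary_comp2 H0 F x))"
    and "\<And>x. x \<in> dom (op_adjoint H0) \<Longrightarrow>
      \<Gamma>2 x = (1 / sqrt 2) *\<^sub>R (boundary_comp1 H0 F x - inv L0 (boundary_comp2 H0 F x))"
  shows "bij_betw (system_restriction H0 F) (unitary_operators :: ('g1 \<Rightarrow> 'g2) set)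
           {H. skew_self_adjoint H \<and> H \<subseteq>\<^sub>m op_adjoint H0} \<and>
         (\<forall>L \<in> (unitary_operators :: ('g1 \<Rightarrow> 'g2) set).
           system_restriction H0 F L = op_neg (triplet_extension H0 \<Gamma>1 \<Gamma>2 (inv L0 \<circ> L)))"
proof
  interpret unitary_boundary_system H0 F
    using assms(1,3,4) by unfold_locales
  show "bij_betw (system_restriction H0 F) (unitary_operators :: ('g1 \<Rightarrow> 'g2) set)
      {H. skew_self_adjoint H \<and> H \<subseteq>\<^sub>m op_adjoint H0}"
    by (rule bij_betw_system_restriction)
  show "\<forall>L \<in> (unitary_operators :: ('g1 \<Rightarrow> 'g2) set).
      system_restriction H0 F L = op_neg (triplet_extension H0 \<Gamma>1 \<Gamma>2 (inv L0 \<circ> L))"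
    using system_restriction_eq_triplet_extension[OF assms(5) _ assms(6,7)] by blast
qed

end
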